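(* In the category $\mathbf{Grp}$ of groups, weak crossed squares are the same as crossed squares. That is, for a commutative square of groups $p_M\colon P\to M$, $p_N\colon P\to N$, $\mu\colon M\to L$, $\nu\colon N\to L$ with $\mu\circ p_M=\nu\circ p_N$, together with actions of $L$ on $M$, $N$ and $P$, the group version of the definition of weak crossed square (involving a group homomorphism $h\colon M\otimes N\to P$) is equivalent to the classical definition of crossed square of groups (involving a function $h\colon M\times N\to P$), the two maps denoted $h$ corresponding to each other through $h(m\otimes n)=h(m,n)$.
   Context: Given a commutative square of groups as in the claim with actions of $L$ on $M,N,P$, the groups $M$ and $N$ act on each other and on $P$ via $\mu$ and $\nu$. Put $\lambda=\mu p_M=\nu p_N$. Crossed square of groups (classical). A function $h\colon M\times N\to P$ is given such that, for all $l\in L$, $m,m'\in M$, $n,n'\in N$, $p\in P$: (X.0) $h(mm',n)={}^mh(m',n)\,h(m,n)$ and $h(m,nn')=h(m,n)\,{}^nh(m,n')$; (X.1) $p_M$ and $p_N$ preserve the actions of $L$, and with the given actions $\mu\colon M\to L$, $\nu\colon N\to L$, $\lambda\colon P\to L$ are crossed modules; (X.2) $p_M(h(m,n))=m\,{}^nm^{-1}$ and $p_N(h(m,n))={}^mn\,n^{-1}$; (X.3) $h(p_M(p),n)=p\,{}^np^{-1}$ and $h(m,p_N(p))={}^mp\,p^{-1}$; (X.4) ${}^lh(m,n)=h({}^lm,{}^ln)$. These are known to be equivalent to internal crossed squares, i.e. to internal crossed modules in the category of crossed modules of groups. Tensor product of groups. For crossed modules $\mu\colon M\to L$, $\nu\colon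 N\to L$, the general categorical non-abelian tensor product (the upper left object of the initial crossed square over $\mu$ and $\nu$) is, in $\mathbf{Grp}$, the Brown-Loday tensor product $M\otimes N$: the group generated by symbols $m\otimes n$ with relations $(mm')\otimes n=({}^mm'\otimes{}^mn)(m\otimes n)$ and $m\otimes(nn')=(m\otimes n)({}^nm\otimes{}^nn')$. Its projections are $\pi_M^{M\otimes N}(m\otimes n)=m\,{}^nm^{-1}$ and $\pi_N^{M\otimes N}(m\otimes n)={}^mn\,n^{-1}$; $L$ acts on it by ${}^l(m\otimes n)={}^lm\otimes{}^ln$; it is a bifunctor on $L$-crossed modules with $(f\otimes g)(m\otimes n)=f(m)\otimes g(n)$. Weak crossed square (in $\mathbf{Grp}$). A group homomorphism $h\colon M\otimes N\to P$ is given such that: (W.1) $p_M$ and $p_N$ are $L$-equivariant, and $\mu$, $\nu$, $\lambda$ with the given actions are $L$-crossed modules; (W.2) $p_M\circ h=\pi_M^{M\otimes N}$ and $p_N\circ h=\pi_N^{M\otimes N}$; (W.3) $h\circ(p_M\otimes 1_N)=\pi_P^{P\otimes N}\colon P\otimes N\to P$ and $h\circ(1_M\otimes p_N)=\pi_P^{M\otimes P}\colon M\otimes P\to P$, where the tensor products are those of the $L$-crossed modules $\lambda,\nu$, respectively $\mu,\lambda$; (W.4) $h$ is equivariant with respect to the actions of $L$ on $M\otimes N$ and $P$. *)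

theory Defs
  imports "HOL-Algebra.Bij"
begin

section \<open>Groups given by generators and relations\<close>

text \<open>
  A word is a list of pairs \<open>(x, e)\<close> of a generator \<open>x\<close> and a flag \<open>e\<close>, where
  \<open>(x, True)\<close> stands for \<open>x\<close> and \<open>(x, False)\<close> for its formal inverse.  A pair of words
  \<open>(u, v) \<in> R\<close> is the relation \<open>u = v\<close>.
\<close>

definition pres_words :: "'g set \<Rightarrow> ('g \<times> bool) list set" where
  "pres_words X = lists (X \<times> UNIV)"

inductive_set pres_cong ::
    "'g set \<Rightarrow> (('g \<times> bool) list \<times> ('g \<times> bool) list) set
      \<Rightarrow> (('g \<times> bool) list \<times> ('g \<times> bool) list) set"
  for X :: "'g set" and R :: "(('g \<times> bool) list \<times> ('g \<times> bool) list) set"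
where
  refl: "u \<in> pres_words X \<Longrightarrow> (u, u) \<in> pres_cong X R"
| sym: "(u, v) \<in> pres_cong X R \<Longrightarrow> (v, u) \<in> pres_cong X R"
| trans: "(u, v) \<in> pres_cong X R \<Longrightarrow> (v, w) \<in> pres_cong X R \<Longrightarrow> (u, w) \<in> pres_cong X R"
| append: "(u, u') \<in> pres_cong X R \<Longrightarrow> (v, v') \<in> pres_cong X R
    \<Longrightarrow> (u @ v, u' @ v') \<in> pres_cong X R"
| cancel: "x \<in> X \<Longrightarrow> ([(x, e), (x, \<not> e)], []) \<in> pres_cong X R"
| rel: "(u, v) \<in> R \<Longrightarrow> u \<in> pres_words X \<Longrightarrow> v \<in> pres_words X \<Longrightarrow> (u, v) \<in> pres_cong X R"

definition presented_group ::
    "'g set \<Rightarrow> (('g \<times> bool) list \<times> ('g \<times> bool) list) set \<Rightarrow> ('g \<times> bool) list set monoid" where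
  "presented_group X R =
     \<lparr>carrier = pres_words X // pres_cong X R,
      monoid.mult = (\<lambda>A B. \<Union>u\<in>A. \<Union>v\<in>B. pres_cong X R `` {u @ v}),
      one = pres_cong X R `` {[]}\<rparr>"

definition pres_gen ::
    "'g set \<Rightarrow> (('g \<times> bool) list \<times> ('g \<times> bool) list) set \<Rightarrow> 'g \<Rightarrow> ('g \<times> bool) list set" where
  "pres_gen X R x = pres_cong X R `` {[(x, True)]}"

fun pres_eval :: "'a monoid \<Rightarrow> ('g \<Rightarrow> 'a) \<Rightarrow> ('g \<times> bool) list \<Rightarrow> 'a" where
  "pres_eval G f [] = \<one>\<^bsub>G\<^esub>"
| "pres_eval G f ((x, e) # w) = (if e then f x else inv\<^bsub>G\<^esub> f x) \<otimes>\<^bsub>G\<^esub> pres_eval G f w"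

text \<open>
  The homomorphism out of a presented group determined by its values \<open>f\<close> on the generators.
  It is meaningful when \<open>f\<close> respects the relations (lemmas \<open>pres_lift_hom\<close>, \<open>pres_lift_gen\<close>).
\<close>

definition pres_lift :: "'a monoid \<Rightarrow> ('g \<Rightarrow> 'a) \<Rightarrow> ('g \<times> bool) list set \<Rightarrow> 'a" where
  "pres_lift G f C = the_elem (pres_eval G f ` C)"


lemma pres_cong_words:
  assumes "(u, v) \<in> pres_cong X R"
  shows "u \<in> pres_words X \<and> v \<in> pres_words X"
  using assms by induction (auto simp: pres_words_def)

lemma equiv_pres_cong: "equiv (pres_words X) (pres_cong X R)"
  by (rule equivI)
     (auto simp: refl_on_def sym_def trans_def
           dest: pres_cong_words intro: pres_cong.refl pres_cong.sym pres_cong.trans)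

lemma append_in_pres_words:
  "u @ v \<in> pres_words X \<longleftrightarrow> u \<in> pres_words X \<and> v \<in> pres_words X"
  by (auto simp: pres_words_def)

lemma pres_cong_class_eq_iff:
  assumes "u \<in> pres_words X" "v \<in> pres_words X"
  shows "pres_cong X R `` {u} = pres_cong X R `` {v} \<longleftrightarrow> (u, v) \<in> pres_cong X R"
  using eq_equiv_class_iff[OF equiv_pres_cong assms] .

lemma presented_group_mult:
  assumes "u \<in> pres_words X" "v \<in> pres_words X"
  shows "pres_cong X R `` {u} \<otimes>\<^bsub>presented_group X R\<^esub> pres_cong X R `` {v}
       = pres_cong X R `` {u @ v}"
proof -
  have "congruent2 (pres_cong X R) (pres_cong X R) (\<lambda>u v. pres_cong X R `` {u @ v})"
    by (rule congruent2I')
       (rule equiv_class_eq[OF equiv_pres_cong pres_cong.append])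
  from UN_equiv_class2[OF equiv_pres_cong equiv_pres_cong this assms]
  show ?thesis by (simp add: presented_group_def)
qed

lemma carrier_presented_group:
  "carrier (presented_group X R) = (\<lambda>u. pres_cong X R `` {u}) ` pres_words X"
  by (auto simp: presented_group_def quotient_def)

lemma pres_cong_inverse:
  assumes "w \<in> pres_words X"
  shows "\<exists>w'\<in>pres_words X. (w' @ w, []) \<in> pres_cong X R"
  using assms
proof (induction w)
  case Nil
  then show ?case by (auto intro!: bexI[of _ "[]"] pres_cong.refl)
next
  case (Cons a w)
  obtain x e where a: "a = (x, e)" by force
  have x: "x \<in> X" and w: "w \<in> pres_words X"
    using Cons.prems a by (auto simp: pres_words_def)
  obtain w' where w': "w' \<in> pres_words X" "(w' @ w, []) \<in> pres_cong X R"
    using Cons.IH w by blast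
  have "([(x, \<not> e), (x, e)], []) \<in> pres_cong X R"
    using pres_cong.cancel[OF x, of "\<not> e"] by simp
  from pres_cong.append[OF this pres_cong.refl[OF w]]
  have "([(x, \<not> e), (x, e)] @ w, w) \<in> pres_cong X R" by simp
  from pres_cong.append[OF pres_cong.refl[OF w'(1)] this]
  have "((w' @ [(x, \<not> e)]) @ (a # w), w' @ w) \<in> pres_cong X R" by (simp add: a)
  then have "((w' @ [(x, \<not> e)]) @ (a # w), []) \<in> pres_cong X R"
    using w'(2) pres_cong.trans by blast
  moreover have "w' @ [(x, \<not> e)] \<in> pres_words X"
    using w' x by (auto simp: pres_words_def)
  ultimately show ?case by blast
qed

lemma group_presented_group: "group (presented_group X R)"
proof (rule groupI)
  let ?c = "\<lambda>u. pres_cong X R `` {u}"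
  have one: "\<one>\<^bsub>presented_group X R\<^esub> = ?c []" by (simp add: presented_group_def)
  have nil: "[] \<in> pres_words X" by (simp add: pres_words_def)
  show "\<one>\<^bsub>presented_group X R\<^esub> \<in> carrier (presented_group X R)"
    using nil by (auto simp: one carrier_presented_group)
  fix A assume "A \<in> carrier (presented_group X R)"
  then obtain u where u: "u \<in> pres_words X" "A = ?c u"
    by (auto simp: carrier_presented_group)
  show "\<one>\<^bsub>presented_group X R\<^esub> \<otimes>\<^bsub>presented_group X R\<^esub> A = A"
    using u nil by (simp add: one presented_group_mult)
  obtain u' where u': "u' \<in> pres_words X" "(u' @ u, []) \<in> pres_cong X R"
    using pres_cong_inverse[OF u(1)] by blast
  have "?c u' \<otimes>\<^bsub>presented_group X R\<^esub> A = \<one>\<^bsub>presented_group X R\<^esub>"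
    using u u' nil by (simp add: one presented_group_mult pres_cong_class_eq_iff append_in_pres_words)
  then show "\<exists>B\<in>carrier (presented_group X R).
      B \<otimes>\<^bsub>presented_group X R\<^esub> A = \<one>\<^bsub>presented_group X R\<^esub>"
    using u' by (auto simp: carrier_presented_group)
  fix B assume "B \<in> carrier (presented_group X R)"
  then obtain v where v: "v \<in> pres_words X" "B = ?c v"
    by (auto simp: carrier_presented_group)
  show "A \<otimes>\<^bsub>presented_group X R\<^esub> B \<in> carrier (presented_group X R)"
    using u v by (auto simp: presented_group_mult append_in_pres_words carrier_presented_group)
  fix C assume "C \<in> carrier (presented_group X R)"
  then obtain w where w: "w \<in> pres_words X" "C = ?c w"
    by (auto simp: carrier_presented_group)
  show "A \<otimes>\<^bsub>presented_group X R\<^esub> B \<otimes>\<^bsub>presented_group X R\<^esub> C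
      = A \<otimes>\<^bsub>presented_group X R\<^esub> (B \<otimes>\<^bsub>presented_group X R\<^esub> C)"
    using u v w by (simp add: presented_group_mult append_in_pres_words)
qed

locale pres_target = group G for G :: "'a monoid" (structure) +
  fixes X :: "'g set" and R :: "(('g \<times> bool) list \<times> ('g \<times> bool) list) set" and f :: "'g \<Rightarrow> 'a"
  assumes f_closed: "x \<in> X \<Longrightarrow> f x \<in> carrier G"
    and f_rel: "(u, v) \<in> R \<Longrightarrow> u \<in> pres_words X \<Longrightarrow> v \<in> pres_words X
      \<Longrightarrow> pres_eval G f u = pres_eval G f v"
begin

lemma pres_eval_closed: "w \<in> pres_words X \<Longrightarrow> pres_eval G f w \<in> carrier G"
  by (induction w) (auto simp: pres_words_def f_closed)

lemma pres_eval_append: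
  "u \<in> pres_words X \<Longrightarrow> v \<in> pres_words X
    \<Longrightarrow> pres_eval G f (u @ v) = pres_eval G f u \<otimes> pres_eval G f v"
proof (induction u)
  case Nil
  then show ?case by (simp add: pres_eval_closed)
next
  case (Cons a u)
  obtain x e where a: "a = (x, e)" by force
  have x: "x \<in> X" and u: "u \<in> pres_words X"
    using Cons.prems a by (auto simp: pres_words_def)
  show ?case
    using Cons.IH[OF u Cons.prems(2)] f_closed[OF x] pres_eval_closed[OF u]
      pres_eval_closed[OF Cons.prems(2)]
    by (simp add: a m_assoc)
qed

lemma pres_eval_cong:
  "(u, v) \<in> pres_cong X R \<Longrightarrow> pres_eval G f u = pres_eval G f v"
proof (induction rule: pres_cong.induct)
  case (append u u' v v')
  then show ?case
    using pres_cong_words[OF append.hyps(1)] pres_cong_words[OF append.hyps(2)]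
    by (simp add: pres_eval_append)
next
  case (cancel x e)
  then show ?case using f_closed[OF cancel] by (cases e) auto
next
  case (rel u v)
  then show ?case by (rule f_rel)
qed simp_all

lemma pres_lift_class:
  assumes "w \<in> pres_words X"
  shows "pres_lift G f (pres_cong X R `` {w}) = pres_eval G f w"
proof -
  have "pres_eval G f ` (pres_cong X R `` {w}) = {pres_eval G f w}"
  proof (rule Set.set_eqI, rule iffI)
    fix a assume "a \<in> pres_eval G f ` (pres_cong X R `` {w})"
    then obtain v where "(w, v) \<in> pres_cong X R" "a = pres_eval G f v" by blast
    then show "a \<in> {pres_eval G f w}" using pres_eval_cong by simp
  qed (use pres_cong.refl[OF assms, of R] in blast)
  then show ?thesis by (simp add: pres_lift_def)
qed

lemma pres_lift_hom: "pres_lift G f \<in> hom (presented_group X R) G"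
  by (rule homI)
     (auto simp: carrier_presented_group pres_lift_class pres_eval_closed presented_group_mult
        append_in_pres_words pres_eval_append)

lemma pres_lift_gen: "x \<in> X \<Longrightarrow> pres_lift G f (pres_gen X R x) = f x"
  unfolding pres_gen_def
  by (subst pres_lift_class) (auto simp: pres_words_def f_closed)

end


section \<open>Crossed modules and the non-abelian tensor product\<close>

text \<open>
  A group \<open>grp A\<close> with a map \<open>bdry A\<close> to \<open>L\<close> and an action \<open>act A\<close> of \<open>L\<close>, written
  \<open>act A l a\<close> for the action of \<open>l\<close> on \<open>a\<close>.  The record carries only data.
\<close>

record ('l, 'a) over_group =
  grp :: "'a monoid"
  bdry :: "'a \<Rightarrow> 'l"
  act :: "'l \<Rightarrow> 'a \<Rightarrow> 'a"

locale crossed_module = L: group L + A: group "grp A"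
  for L :: "'l monoid" and A :: "('l, 'a) over_group" +
  assumes bdry_hom: "bdry A \<in> hom (grp A) L"
    and act_hom: "act A \<in> hom L (AutoGroup (grp A))"
    and bdry_equivariant: "l \<in> carrier L \<Longrightarrow> a \<in> carrier (grp A)
      \<Longrightarrow> bdry A (act A l a) = l \<otimes>\<^bsub>L\<^esub> bdry A a \<otimes>\<^bsub>L\<^esub> inv\<^bsub>L\<^esub> l"
    and peiffer: "a \<in> carrier (grp A) \<Longrightarrow> a' \<in> carrier (grp A)
      \<Longrightarrow> act A (bdry A a) a' = a \<otimes>\<^bsub>grp A\<^esub> a' \<otimes>\<^bsub>grp A\<^esub> inv\<^bsub>grp A\<^esub> a"

text \<open>
  In the relations, \<open>grp A\<close> and \<open>grp B\<close> act on each other through \<open>L\<close>, and each acts on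
  itself by conjugation.
\<close>

definition tensor_rels ::
    "('l, 'a) over_group \<Rightarrow> ('l, 'b) over_group
      \<Rightarrow> ((('a \<times> 'b) \<times> bool) list \<times> (('a \<times> 'b) \<times> bool) list) set" where
  "tensor_rels A B =
     {([((a \<otimes>\<^bsub>grp A\<^esub> a', b), True)],
       [((a \<otimes>\<^bsub>grp A\<^esub> a' \<otimes>\<^bsub>grp A\<^esub> inv\<^bsub>grp A\<^esub> a, act B (bdry A a) b), True), ((a, b), True)])
       | a a' b. a \<in> carrier (grp A) \<and> a' \<in> carrier (grp A) \<and> b \<in> carrier (grp B)}
   \<union> {([((a, b \<otimes>\<^bsub>grp B\<^esub> b'), True)],
       [((a, b), True), ((act A (bdry B b) a, b \<otimes>\<^bsub>grp B\<^esub> b' \<otimes>\<^bsub>grp B\<^esub> inv\<^bsub>grp B\<^esub> b), True)])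
       | a b b'. a \<in> carrier (grp A) \<and> b \<in> carrier (grp B) \<and> b' \<in> carrier (grp B)}"

definition tensor ::
    "('l, 'a) over_group \<Rightarrow> ('l, 'b) over_group \<Rightarrow> (('a \<times> 'b) \<times> bool) list set monoid" where
  "tensor A B = presented_group (carrier (grp A) \<times> carrier (grp B)) (tensor_rels A B)"

definition tensor_gen ::
    "('l, 'a) over_group \<Rightarrow> ('l, 'b) over_group \<Rightarrow> 'a \<Rightarrow> 'b \<Rightarrow> (('a \<times> 'b) \<times> bool) list set" where
  "tensor_gen A B a b =
     pres_gen (carrier (grp A) \<times> carrier (grp B)) (tensor_rels A B) (a, b)"

definition tensor_proj1 ::
    "('l, 'a) over_group \<Rightarrow> ('l, 'b) over_group \<Rightarrow> (('a \<times> 'b) \<times> bool) list set \<Rightarrow> 'a" where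
  "tensor_proj1 A B =
     pres_lift (grp A) (\<lambda>(a, b). a \<otimes>\<^bsub>grp A\<^esub> act A (bdry B b) (inv\<^bsub>grp A\<^esub> a))"

definition tensor_proj2 ::
    "('l, 'a) over_group \<Rightarrow> ('l, 'b) over_group \<Rightarrow> (('a \<times> 'b) \<times> bool) list set \<Rightarrow> 'b" where
  "tensor_proj2 A B =
     pres_lift (grp B) (\<lambda>(a, b). act B (bdry A a) b \<otimes>\<^bsub>grp B\<^esub> inv\<^bsub>grp B\<^esub> b)"

definition tensor_act ::
    "('l, 'a) over_group \<Rightarrow> ('l, 'b) over_group \<Rightarrow> 'l
      \<Rightarrow> (('a \<times> 'b) \<times> bool) list set \<Rightarrow> (('a \<times> 'b) \<times> bool) list set" where
  "tensor_act A B l =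
     pres_lift (tensor A B) (\<lambda>(a, b). tensor_gen A B (act A l a) (act B l b))"

text \<open>The homomorphism \<open>f \<otimes> g\<close> into the tensor product of \<open>A'\<close> and \<open>B'\<close>.\<close>

definition tensor_map ::
    "('l, 'a) over_group \<Rightarrow> ('l, 'b) over_group \<Rightarrow> ('c \<Rightarrow> 'a) \<Rightarrow> ('d \<Rightarrow> 'b)
      \<Rightarrow> (('c \<times> 'd) \<times> bool) list set \<Rightarrow> (('a \<times> 'b) \<times> bool) list set" where
  "tensor_map A' B' f g =
     pres_lift (tensor A' B') (\<lambda>(c, d). tensor_gen A' B' (f c) (g d))"


section \<open>Crossed squares and weak crossed squares\<close>

locale group_square =
  L: group L + M: group M + N: group N + P: group P
  for L :: "'l monoid" and M :: "'m monoid" and N :: "'n monoid" and P :: "'p monoid" +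
  fixes p\<^sub>M :: "'p \<Rightarrow> 'm" and p\<^sub>N :: "'p \<Rightarrow> 'n" and \<mu> :: "'m \<Rightarrow> 'l" and \<nu> :: "'n \<Rightarrow> 'l"
    and act\<^sub>M :: "'l \<Rightarrow> 'm \<Rightarrow> 'm" and act\<^sub>N :: "'l \<Rightarrow> 'n \<Rightarrow> 'n" and act\<^sub>P :: "'l \<Rightarrow> 'p \<Rightarrow> 'p"
  assumes pM_hom: "p\<^sub>M \<in> hom P M"
    and pN_hom: "p\<^sub>N \<in> hom P N"
    and mu_hom: "\<mu> \<in> hom M L"
    and nu_hom: "\<nu> \<in> hom N L"
    and commutes: "p \<in> carrier P \<Longrightarrow> \<mu> (p\<^sub>M p) = \<nu> (p\<^sub>N p)"
    and actM_hom: "act\<^sub>M \<in> hom L (AutoGroup M)"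
    and actN_hom: "act\<^sub>N \<in> hom L (AutoGroup N)"
    and actP_hom: "act\<^sub>P \<in> hom L (AutoGroup P)"
begin

abbreviation "over\<^sub>M \<equiv> \<lparr>grp = M, bdry = \<mu>, act = act\<^sub>M\<rparr>"
abbreviation "over\<^sub>N \<equiv> \<lparr>grp = N, bdry = \<nu>, act = act\<^sub>N\<rparr>"
abbreviation "over\<^sub>P \<equiv> \<lparr>grp = P, bdry = (\<lambda>p. \<mu> (p\<^sub>M p)), act = act\<^sub>P\<rparr>"

end

locale crossed_square = group_square L M N P p\<^sub>M p\<^sub>N \<mu> \<nu> act\<^sub>M act\<^sub>N act\<^sub>P
  for L :: "'l monoid" and M :: "'m monoid" and N :: "'n monoid" and P :: "'p monoid"
    and p\<^sub>M p\<^sub>N \<mu> \<nu> act\<^sub>M act\<^sub>N act\<^sub>P +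
  fixes h :: "'m \<times> 'n \<Rightarrow> 'p"
  assumes h_closed: "h \<in> carrier M \<times> carrier N \<rightarrow> carrier P"
    and X0_left: "\<lbrakk>m \<in> carrier M; m' \<in> carrier M; n \<in> carrier N\<rbrakk>
      \<Longrightarrow> h (m \<otimes>\<^bsub>M\<^esub> m', n) = act\<^sub>P (\<mu> m) (h (m', n)) \<otimes>\<^bsub>P\<^esub> h (m, n)"
    and X0_right: "\<lbrakk>m \<in> carrier M; n \<in> carrier N; n' \<in> carrier N\<rbrakk>
      \<Longrightarrow> h (m, n \<otimes>\<^bsub>N\<^esub> n') = h (m, n) \<otimes>\<^bsub>P\<^esub> act\<^sub>P (\<nu> n) (h (m, n'))"
    and X1_pM: "\<lbrakk>l \<in> carrier L; p \<in> carrier P\<rbrakk> \<Longrightarrow> p\<^sub>M (act\<^sub>P l p) = act\<^sub>M l (p\<^sub>M p)"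
    and X1_pN: "\<lbrakk>l \<in> carrier L; p \<in> carrier P\<rbrakk> \<Longrightarrow> p\<^sub>N (act\<^sub>P l p) = act\<^sub>N l (p\<^sub>N p)"
    and X1_mu: "crossed_module L over\<^sub>M"
    and X1_nu: "crossed_module L over\<^sub>N"
    and X1_lambda: "crossed_module L over\<^sub>P"
    and X2_M: "\<lbrakk>m \<in> carrier M; n \<in> carrier N\<rbrakk>
      \<Longrightarrow> p\<^sub>M (h (m, n)) = m \<otimes>\<^bsub>M\<^esub> act\<^sub>M (\<nu> n) (inv\<^bsub>M\<^esub> m)"
    and X2_N: "\<lbrakk>m \<in> carrier M; n \<in> carrier N\<rbrakk>
      \<Longrightarrow> p\<^sub>N (h (m, n)) = act\<^sub>N (\<mu> m) n \<otimes>\<^bsub>N\<^esub> inv\<^bsub>N\<^esub> n"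
    and X3_M: "\<lbrakk>p \<in> carrier P; n \<in> carrier N\<rbrakk>
      \<Longrightarrow> h (p\<^sub>M p, n) = p \<otimes>\<^bsub>P\<^esub> act\<^sub>P (\<nu> n) (inv\<^bsub>P\<^esub> p)"
    and X3_N: "\<lbrakk>m \<in> carrier M; p \<in> carrier P\<rbrakk>
      \<Longrightarrow> h (m, p\<^sub>N p) = act\<^sub>P (\<mu> m) p \<otimes>\<^bsub>P\<^esub> inv\<^bsub>P\<^esub> p"
    and X4: "\<lbrakk>l \<in> carrier L; m \<in> carrier M; n \<in> carrier N\<rbrakk>
      \<Longrightarrow> act\<^sub>P l (h (m, n)) = h (act\<^sub>M l m, act\<^sub>N l n)"

locale weak_crossed_square = group_square L M N P p\<^sub>M p\<^sub>N \<mu> \<nu> act\<^sub>M act\<^sub>N act\<^sub>P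
  for L :: "'l monoid" and M :: "'m monoid" and N :: "'n monoid" and P :: "'p monoid"
    and p\<^sub>M p\<^sub>N \<mu> \<nu> act\<^sub>M act\<^sub>N act\<^sub>P +
  fixes h :: "(('m \<times> 'n) \<times> bool) list set \<Rightarrow> 'p"
  assumes h_hom: "h \<in> hom (tensor over\<^sub>M over\<^sub>N) P"
    and W1_pM: "\<lbrakk>l \<in> carrier L; p \<in> carrier P\<rbrakk> \<Longrightarrow> p\<^sub>M (act\<^sub>P l p) = act\<^sub>M l (p\<^sub>M p)"
    and W1_pN: "\<lbrakk>l \<in> carrier L; p \<in> carrier P\<rbrakk> \<Longrightarrow> p\<^sub>N (act\<^sub>P l p) = act\<^sub>N l (p\<^sub>N p)"
    and W1_mu: "crossed_module L over\<^sub>M"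
    and W1_nu: "crossed_module L over\<^sub>N"
    and W1_lambda: "crossed_module L over\<^sub>P"
    and W2_M: "t \<in> carrier (tensor over\<^sub>M over\<^sub>N) \<Longrightarrow> p\<^sub>M (h t) = tensor_proj1 over\<^sub>M over\<^sub>N t"
    and W2_N: "t \<in> carrier (tensor over\<^sub>M over\<^sub>N) \<Longrightarrow> p\<^sub>N (h t) = tensor_proj2 over\<^sub>M over\<^sub>N t"
    and W3_M: "r \<in> carrier (tensor over\<^sub>P over\<^sub>N)
      \<Longrightarrow> h (tensor_map over\<^sub>M over\<^sub>N p\<^sub>M (\<lambda>n. n) r) = tensor_proj1 over\<^sub>P over\<^sub>N r"
    and W3_N: "s \<in> carrier (tensor over\<^sub>M over\<^sub>P)
      \<Longrightarrow> h (tensor_map over\<^sub>M over\<^sub>N (\<lambda>m. m) p\<^sub>N s) = tensor_proj2 over\<^sub>M over\<^sub>P s"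
    and W4: "\<lbrakk>l \<in> carrier L; t \<in> carrier (tensor over\<^sub>M over\<^sub>N)\<rbrakk>
      \<Longrightarrow> h (tensor_act over\<^sub>M over\<^sub>N l t) = act\<^sub>P l (h t)"

end

theory Submission
  imports Defs
begin

text \<open>
  By the Peiffer identity, conjugation by \<open>a\<close> in the Brown--Loday relations is the action of the
  boundary of \<open>a\<close>.  A homomorphism out of \<open>M \<otimes> N\<close> is therefore a function \<open>h\<close> on
  \<open>M \<times> N\<close> satisfying \<open>h (m m', n) = h (\<^sup>mm', \<^sup>mn) h (m, n)\<close> and its mirror image, and
  equivariance of \<open>h\<close> turns these rules into (X.0).  Each of the axioms (W.2)--(W.4) is an equality of two
  homomorphisms out of a tensor product, so it may be tested on generators, where it reads (X.2)--(X.4).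
\<close>

section \<open>Actions by automorphisms and reduction of group words\<close>

locale aut_action = L: group L + G: group G
  for L :: "'l monoid" and G :: "'a monoid" and \<phi> :: "'l \<Rightarrow> 'a \<Rightarrow> 'a" +
  assumes hom: "\<phi> \<in> hom L (AutoGroup G)"
begin

lemma aut: "l \<in> carrier L \<Longrightarrow> \<phi> l \<in> auto G"
  using hom_in_carrier[OF hom] by (simp add: AutoGroup_def)

lemma act_endo: "l \<in> carrier L \<Longrightarrow> \<phi> l \<in> hom G G"
  using aut by (simp add: auto_def)

lemma act_closed [simp]: "l \<in> carrier L \<Longrightarrow> a \<in> carrier G \<Longrightarrow> \<phi> l a \<in> carrier G"
  using act_endo hom_in_carrier by fast

lemma act_mult: "\<lbrakk>l \<in> carrier L; a \<in> carrier G; b \<in> carrier G\<rbrakk>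
    \<Longrightarrow> \<phi> l (a \<otimes>\<^bsub>G\<^esub> b) = \<phi> l a \<otimes>\<^bsub>G\<^esub> \<phi> l b"
  using act_endo by (simp add: hom_def)

lemma act_inv: "\<lbrakk>l \<in> carrier L; a \<in> carrier G\<rbrakk> \<Longrightarrow> \<phi> l (inv\<^bsub>G\<^esub> a) = inv\<^bsub>G\<^esub> \<phi> l a"
  by (rule group_hom.hom_inv[OF group_hom.intro])
    (auto intro: G.group_axioms act_endo simp: group_hom_axioms_def)

lemma act_comp: "\<lbrakk>k \<in> carrier L; l \<in> carrier L; a \<in> carrier G\<rbrakk>
    \<Longrightarrow> \<phi> k (\<phi> l a) = \<phi> (k \<otimes>\<^bsub>L\<^esub> l) a"
proof -
  assume kl: "k \<in> carrier L" "l \<in> carrier L" and a: "a \<in> carrier G"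
  \<comment> \<open>Products in \<open>AutoGroup\<close> are composites restricted to the carrier,
    so this equation of maps gives information only at elements of \<open>G\<close>.\<close>
  have "\<phi> (k \<otimes>\<^bsub>L\<^esub> l) = compose (carrier G) (\<phi> k) (\<phi> l)"
    using hom_mult[OF hom kl] aut[OF kl(1)] aut[OF kl(2)]
    by (simp add: AutoGroup_def BijGroup_def auto_def)
  then show ?thesis using a by (simp add: compose_eq)
qed

lemma act_one: "a \<in> carrier G \<Longrightarrow> \<phi> \<one>\<^bsub>L\<^esub> a = a"
  using hom_one[OF hom L.group_axioms G.AutoGroup] by (simp add: AutoGroup_def BijGroup_def)

lemma act_inv_cancel:
  assumes "l \<in> carrier L" "a \<in> carrier G"
  shows "\<phi> l (\<phi> (inv\<^bsub>L\<^esub> l) a) = a" "\<phi> (inv\<^bsub>L\<^esub> l) (\<phi> l a) = a"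
  using assms by (simp_all add: act_comp act_one)

end

context group
begin

lemma inv_mult_cancel_left: "a \<in> carrier G \<Longrightarrow> b \<in> carrier G \<Longrightarrow> inv a \<otimes> (a \<otimes> b) = b"
  by (simp flip: m_assoc)

lemma mult_inv_cancel_left: "a \<in> carrier G \<Longrightarrow> b \<in> carrier G \<Longrightarrow> a \<otimes> (inv a \<otimes> b) = b"
  by (simp flip: m_assoc)

text \<open>With the standard simp rules for units and inverses, these bring a group word into
  right-nested reduced form. This settles the word identities behind the two projections of the
  tensor product.\<close>

lemmas cancel_simps = m_assoc inv_mult_group inv_mult_cancel_left mult_inv_cancel_left

end

lemma id_hom: "(\<lambda>x. x) \<in> hom G G"
  by (simp add: hom_def)

section \<open>Homomorphisms determined by their values on generators\<close>

text \<open>Uniqueness half of the universal property of a presentation. The class of a word is the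
  product of the classes of its letters, so induction on words reduces the claim to single
  letters.\<close>

lemma presented_group_hom_eqI:
  assumes G: "group G"
    and \<phi>: "\<phi> \<in> hom (presented_group X R) G" and \<psi>: "\<psi> \<in> hom (presented_group X R) G"
    and eq: "\<And>x. x \<in> X \<Longrightarrow> \<phi> (pres_gen X R x) = \<psi> (pres_gen X R x)"
    and t: "t \<in> carrier (presented_group X R)"
  shows "\<phi> t = \<psi> t"
proof -
  interpret \<phi>: group_hom "presented_group X R" G \<phi>
    using \<phi> G by (simp add: group_hom_def group_hom_axioms_def group_presented_group)
  interpret \<psi>: group_hom "presented_group X R" G \<psi>
    using \<psi> G by (simp add: group_hom_def group_hom_axioms_def group_presented_group)
  let ?c = "\<lambda>u. pres_cong X R `` {u}"
  have one: "?c [] = \<one>\<^bsub>presented_group X R\<^esub>" by (simp add: presented_group_def)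
  have cl: "u \<in> pres_words X \<Longrightarrow> ?c u \<in> carrier (presented_group X R)" for u
    by (auto simp: carrier_presented_group)
  have "\<phi> (?c w) = \<psi> (?c w)" if "w \<in> pres_words X" for w
    using that
  proof (induction w)
    case Nil
    then show ?case by (simp add: one)
  next
    case (Cons a w)
    obtain x e where a: "a = (x, e)" by force
    have x: "x \<in> X" and w: "w \<in> pres_words X"
      using Cons.prems a by (auto simp: pres_words_def)
    have xw: "[(x, e)] \<in> pres_words X" for e using x by (simp add: pres_words_def)
    \<comment> \<open>Agreement is assumed on positive letters only. A negative letter represents
      the inverse of its generator, and homomorphisms preserve inverses.\<close>
    have "?c [(x, False)] \<otimes>\<^bsub>presented_group X R\<^esub> ?c [(x, True)] = ?c ([(x, False)] @ [(x, True)])"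
      by (rule presented_group_mult[OF xw xw])
    also have "\<dots> = \<one>\<^bsub>presented_group X R\<^esub>"
      using equiv_class_eq[OF equiv_pres_cong pres_cong.cancel[OF x, of False]] by (simp add: one)
    finally have "?c [(x, False)] = inv\<^bsub>presented_group X R\<^esub> ?c [(x, True)]"
      by (rule group.inv_equality[OF group_presented_group _ cl[OF xw] cl[OF xw], symmetric])
    then have "\<phi> (?c [(x, e)]) = \<psi> (?c [(x, e)])"
      using eq[OF x] cl[OF xw] by (cases e) (simp_all add: pres_gen_def)
    moreover have "?c (a # w) = ?c [(x, e)] \<otimes>\<^bsub>presented_group X R\<^esub> ?c w"
      using presented_group_mult[OF xw w] by (simp add: a)
    ultimately show ?case
      using Cons.IH[OF w] cl[OF xw] cl[OF w] by simp
  qed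
  then show ?thesis using t by (auto simp: carrier_presented_group)
qed

lemma group_tensor: "group (tensor A B)"
  by (simp add: tensor_def group_presented_group)

lemma tensor_gen_closed [intro]:
  "a \<in> carrier (grp A) \<Longrightarrow> b \<in> carrier (grp B) \<Longrightarrow> tensor_gen A B a b \<in> carrier (tensor A B)"
  by (auto simp: tensor_gen_def tensor_def pres_gen_def carrier_presented_group pres_words_def)

text \<open>Serves both the injectivity of the correspondence and the passage from (X.2)--(X.4) to
  (W.2)--(W.4).\<close>

lemma tensor_hom_eqI:
  assumes "group G" "\<phi> \<in> hom (tensor A B) G" "\<psi> \<in> hom (tensor A B) G"
    and "\<And>a b. a \<in> carrier (grp A) \<Longrightarrow> b \<in> carrier (grp B)
      \<Longrightarrow> \<phi> (tensor_gen A B a b) = \<psi> (tensor_gen A B a b)"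
    and "t \<in> carrier (tensor A B)"
  shows "\<phi> t = \<psi> t"
  using assms presented_group_hom_eqI[of G \<phi> "carrier (grp A) \<times> carrier (grp B)" "tensor_rels A B" \<psi> t]
  by (auto simp: tensor_def tensor_gen_def)

section \<open>Consequences of the crossed module axioms\<close>

context crossed_module
begin

sublocale action: aut_action L "grp A" "act A"
  using act_hom by unfold_locales

sublocale bdry: group_hom "grp A" L "bdry A"
  using bdry_hom by unfold_locales

text \<open>The Peiffer identity at the inverse of \<open>a\<close>. It evaluates the action of the
  inverse factor that \<open>bdry_equivariant\<close> produces.\<close>

lemma act_bdry_inv: "\<lbrakk>a \<in> carrier (grp A); a' \<in> carrier (grp A)\<rbrakk>
    \<Longrightarrow> act A (inv\<^bsub>L\<^esub> bdry A a) a' = inv\<^bsub>grp A\<^esub> a \<otimes>\<^bsub>grp A\<^esub> a' \<otimes>\<^bsub>grp A\<^esub> a"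
  using peiffer[of "inv\<^bsub>grp A\<^esub> a" a'] by simp

end

section \<open>Crossed pairings and the universal property of the tensor product\<close>

text \<open>These are the crossed pairings of Brown and Loday. Conjugation is written as the action
  of a boundary, so that a single element of \<open>L\<close> acts on both arguments, as in (X.4).
  The target is a bare group, which may be a tensor product, one of its factors or
  \<open>P\<close>.\<close>

definition crossed_pairing ::
    "('l, 'a) over_group \<Rightarrow> ('l, 'b) over_group \<Rightarrow> 'c monoid \<Rightarrow> ('a \<times> 'b \<Rightarrow> 'c) \<Rightarrow> bool" where
  "crossed_pairing A B G f \<longleftrightarrow> f \<in> carrier (grp A) \<times> carrier (grp B) \<rightarrow> carrier G \<and>
    (\<forall>a\<in>carrier (grp A). \<forall>a'\<in>carrier (grp A). \<forall>b\<in>carrier (grp B).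
      f (a \<otimes>\<^bsub>grp A\<^esub> a', b) = f (act A (bdry A a) a', act B (bdry A a) b) \<otimes>\<^bsub>G\<^esub> f (a, b)) \<and>
    (\<forall>a\<in>carrier (grp A). \<forall>b\<in>carrier (grp B). \<forall>b'\<in>carrier (grp B).
      f (a, b \<otimes>\<^bsub>grp B\<^esub> b') = f (a, b) \<otimes>\<^bsub>G\<^esub> f (act A (bdry B b) a, act B (bdry B b) b'))"

lemma crossed_pairing_left:
  "crossed_pairing A B G f \<Longrightarrow> a \<in> carrier (grp A) \<Longrightarrow> a' \<in> carrier (grp A) \<Longrightarrow> b \<in> carrier (grp B)
    \<Longrightarrow> f (a \<otimes>\<^bsub>grp A\<^esub> a', b) = f (act A (bdry A a) a', act B (bdry A a) b) \<otimes>\<^bsub>G\<^esub> f (a, b)"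
  by (simp add: crossed_pairing_def)

lemma crossed_pairing_right:
  "crossed_pairing A B G f \<Longrightarrow> a \<in> carrier (grp A) \<Longrightarrow> b \<in> carrier (grp B) \<Longrightarrow> b' \<in> carrier (grp B)
    \<Longrightarrow> f (a, b \<otimes>\<^bsub>grp B\<^esub> b') = f (a, b) \<otimes>\<^bsub>G\<^esub> f (act A (bdry B b) a, act B (bdry B b) b')"
  by (simp add: crossed_pairing_def)

locale crossed_module_pair = A: crossed_module L A + B: crossed_module L B
  for L :: "'l monoid" and A :: "('l, 'a) over_group" and B :: "('l, 'b) over_group"
begin

text \<open>This is the universal crossed pairing: its two rules are the relations in
  \<open>tensor_rels\<close>, with conjugations turned into boundary actions by the Peiffer
  identity.\<close>

lemma tensor_gen_crossed_pairing: "crossed_pairing A B (tensor A B) (\<lambda>(a, b). tensor_gen A B a b)"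
proof -
  let ?X = "carrier (grp A) \<times> carrier (grp B)" and ?R = "tensor_rels A B"
  \<comment> \<open>A relation between one letter and a word of two letters is read as a product in
    the presented group.\<close>
  have rel: "pres_gen ?X ?R x = pres_gen ?X ?R y \<otimes>\<^bsub>tensor A B\<^esub> pres_gen ?X ?R z"
    if xyz: "x \<in> ?X" "y \<in> ?X" "z \<in> ?X" and "([(x, True)], [(y, True), (z, True)]) \<in> ?R" for x y z
  proof -
    have w: "[(x, True)] \<in> pres_words ?X" "[(y, True)] \<in> pres_words ?X" "[(z, True)] \<in> pres_words ?X"
      "[(y, True), (z, True)] \<in> pres_words ?X"
      using xyz by (simp_all add: pres_words_def)
    have "pres_gen ?X ?R x = pres_cong ?X ?R `` {[(y, True)] @ [(z, True)]}"
      unfolding pres_gen_def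
      by (rule equiv_class_eq[OF equiv_pres_cong]) (use that w in \<open>auto intro: pres_cong.rel\<close>)
    then show ?thesis
      unfolding tensor_def pres_gen_def using presented_group_mult[OF w(2,3)] by simp
  qed
  have left: "tensor_gen A B (a \<otimes>\<^bsub>grp A\<^esub> a') b =
      tensor_gen A B (act A (bdry A a) a') (act B (bdry A a) b) \<otimes>\<^bsub>tensor A B\<^esub> tensor_gen A B a b"
    if "a \<in> carrier (grp A)" "a' \<in> carrier (grp A)" "b \<in> carrier (grp B)" for a a' b
    unfolding tensor_gen_def by (rule rel) (use that in \<open>auto simp: tensor_rels_def A.peiffer\<close>)
  have right: "tensor_gen A B a (b \<otimes>\<^bsub>grp B\<^esub> b') =
      tensor_gen A B a b \<otimes>\<^bsub>tensor A B\<^esub> tensor_gen A B (act A (bdry B b) a) (act B (bdry B b) b')"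
    if "a \<in> carrier (grp A)" "b \<in> carrier (grp B)" "b' \<in> carrier (grp B)" for a b b'
    unfolding tensor_gen_def by (rule rel) (use that in \<open>auto simp: tensor_rels_def B.peiffer\<close>)
  show ?thesis
    by (auto simp: crossed_pairing_def left right)
qed

context
  fixes G :: "'c monoid" and f :: "'a \<times> 'b \<Rightarrow> 'c"
  assumes G: "group G" and f: "crossed_pairing A B G f"
begin

text \<open>Existence half of the universal property: a crossed pairing respects the Brown--Loday
  relations and hence extends to the tensor product.\<close>

lemma tensor_target: "pres_target G (carrier (grp A) \<times> carrier (grp B)) (tensor_rels A B) f"
proof -
  interpret G: group G by (rule G)
  have cl: "x \<in> carrier (grp A) \<times> carrier (grp B) \<Longrightarrow> f x \<in> carrier G" for x
    using f by (auto simp: crossed_pairing_def)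
  show ?thesis
  proof
    fix u v assume "(u, v) \<in> tensor_rels A B"
    \<comment> \<open>Read from right to left, the Peiffer identities turn the conjugations in
      \<open>tensor_rels\<close> into boundary actions, so that the pairing rules match.\<close>
    then show "pres_eval G f u = pres_eval G f v"
      using crossed_pairing_left[OF f] crossed_pairing_right[OF f]
      by (auto simp: tensor_rels_def cl simp flip: A.peiffer B.peiffer)
  qed (rule cl)
qed

lemma tensor_lift_hom: "pres_lift G f \<in> hom (tensor A B) G"
  unfolding tensor_def by (rule pres_target.pres_lift_hom[OF tensor_target])

lemma tensor_lift_gen: "\<lbrakk>a \<in> carrier (grp A); b \<in> carrier (grp B)\<rbrakk>
    \<Longrightarrow> pres_lift G f (tensor_gen A B a b) = f (a, b)"
  unfolding tensor_gen_def by (rule pres_target.pres_lift_gen[OF tensor_target]) simp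

end

text \<open>Equivariance expands the boundary of an acted-on element into a conjugate in
  \<open>L\<close>. The outer factors of this conjugate then act by conjugation in the left rule and
  cancel in the right rule.\<close>

lemma proj1_crossed_pairing:
  "crossed_pairing A B (grp A) (\<lambda>(a, b). a \<otimes>\<^bsub>grp A\<^esub> act A (bdry B b) (inv\<^bsub>grp A\<^esub> a))"
  unfolding crossed_pairing_def
  by (auto simp: A.action.act_mult A.action.act_inv A.action.act_comp[symmetric]
      B.bdry_equivariant A.action.act_inv_cancel A.peiffer A.act_bdry_inv A.A.cancel_simps)

lemma proj2_crossed_pairing:
  "crossed_pairing A B (grp B) (\<lambda>(a, b). act B (bdry A a) b \<otimes>\<^bsub>grp B\<^esub> inv\<^bsub>grp B\<^esub> b)"
  unfolding crossed_pairing_def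
  by (auto simp: B.action.act_mult B.action.act_inv B.action.act_comp[symmetric]
      A.bdry_equivariant B.action.act_inv_cancel B.peiffer B.act_bdry_inv B.A.cancel_simps)

text \<open>The hypotheses speak of the mixed actions rather than of boundaries, because the lemma
  also serves the action of an element of \<open>L\<close>, which conjugates boundaries.\<close>

lemma map_crossed_pairing:
  fixes C :: "('l, 'c) over_group" and D :: "('l, 'd) over_group"
  assumes "crossed_module_pair L C D"
    and f: "f \<in> hom (grp C) (grp A)" and g: "g \<in> hom (grp D) (grp B)"
    and f_act: "\<And>c d. c \<in> carrier (grp C) \<Longrightarrow> d \<in> carrier (grp D)
      \<Longrightarrow> f (act C (bdry D d) c) = act A (bdry B (g d)) (f c)"
    and g_act: "\<And>c d. c \<in> carrier (grp C) \<Longrightarrow> d \<in> carrier (grp D)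
      \<Longrightarrow> g (act D (bdry C c) d) = act B (bdry A (f c)) (g d)"
  shows "crossed_pairing C D (tensor A B) (\<lambda>(c, d). tensor_gen A B (f c) (g d))"
proof -
  interpret CD: crossed_module_pair L C D by fact
  interpret f: group_hom "grp C" "grp A" f using f by unfold_locales
  interpret g: group_hom "grp D" "grp B" g using g by unfold_locales
  \<comment> \<open>On its own group a boundary acts by conjugation, which any homomorphism
    preserves; \<open>f_act\<close> and \<open>g_act\<close> cover the mixed actions.\<close>
  have "f (act C (bdry C c) c') = act A (bdry A (f c)) (f c')"
    if "c \<in> carrier (grp C)" "c' \<in> carrier (grp C)" for c c'
    using that by (simp add: CD.A.peiffer A.peiffer)
  moreover have "g (act D (bdry D d) d') = act B (bdry B (g d)) (g d')"
    if "d \<in> carrier (grp D)" "d' \<in> carrier (grp D)" for d d'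
    using that by (simp add: CD.B.peiffer B.peiffer)
  ultimately show ?thesis
    using crossed_pairing_left[OF tensor_gen_crossed_pairing] crossed_pairing_right[OF tensor_gen_crossed_pairing]
    by (auto simp: crossed_pairing_def f_act g_act)
qed

text \<open>Acting by \<open>l\<close> replaces a boundary \<open>x\<close> by
  \<open>l x l^-1\<close>, and \<open>(l x l^-1) l = l x\<close>.\<close>

lemma act_crossed_pairing:
  assumes l: "l \<in> carrier L"
  shows "crossed_pairing A B (tensor A B) (\<lambda>(a, b). tensor_gen A B (act A l a) (act B l b))"
  by (rule map_crossed_pairing[OF crossed_module_pair_axioms A.action.act_endo[OF l] B.action.act_endo[OF l]])
    (use l in \<open>simp_all add: A.action.act_comp B.action.act_comp A.bdry_equivariant
      B.bdry_equivariant A.L.m_assoc\<close>)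

lemmas tensor_proj1_hom =
  tensor_lift_hom[OF A.A.group_axioms proj1_crossed_pairing, folded tensor_proj1_def]
lemmas tensor_proj1_gen =
  tensor_lift_gen[OF A.A.group_axioms proj1_crossed_pairing, folded tensor_proj1_def, simplified]
lemmas tensor_proj2_hom =
  tensor_lift_hom[OF B.A.group_axioms proj2_crossed_pairing, folded tensor_proj2_def]
lemmas tensor_proj2_gen =
  tensor_lift_gen[OF B.A.group_axioms proj2_crossed_pairing, folded tensor_proj2_def, simplified]
lemmas tensor_act_hom =
  tensor_lift_hom[OF group_tensor act_crossed_pairing, folded tensor_act_def]
lemmas tensor_act_gen =
  tensor_lift_gen[OF group_tensor act_crossed_pairing, folded tensor_act_def, simplified]

end

section \<open>Squares of crossed modules without a pairing\<close>

text \<open>Isolates (W.1), which coincides with (X.1), so that both kinds of square share the three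
  tensor products occurring in (W.2)--(W.4).\<close>

locale crossed_module_square = group_square L M N P p\<^sub>M p\<^sub>N \<mu> \<nu> act\<^sub>M act\<^sub>N act\<^sub>P
  for L :: "'l monoid" and M :: "'m monoid" and N :: "'n monoid" and P :: "'p monoid"
    and p\<^sub>M p\<^sub>N \<mu> \<nu> act\<^sub>M act\<^sub>N act\<^sub>P +
  assumes pM_equivariant: "\<lbrakk>l \<in> carrier L; p \<in> carrier P\<rbrakk> \<Longrightarrow> p\<^sub>M (act\<^sub>P l p) = act\<^sub>M l (p\<^sub>M p)"
    and pN_equivariant: "\<lbrakk>l \<in> carrier L; p \<in> carrier P\<rbrakk> \<Longrightarrow> p\<^sub>N (act\<^sub>P l p) = act\<^sub>N l (p\<^sub>N p)"
    and crossed_mu: "crossed_module L over\<^sub>M"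
    and crossed_nu: "crossed_module L over\<^sub>N"
    and crossed_lambda: "crossed_module L over\<^sub>P"
begin

sublocale MN: crossed_module_pair L over\<^sub>M over\<^sub>N
  using crossed_mu crossed_nu by (rule crossed_module_pair.intro)

sublocale PN: crossed_module_pair L over\<^sub>P over\<^sub>N
  using crossed_lambda crossed_nu by (rule crossed_module_pair.intro)

sublocale MP: crossed_module_pair L over\<^sub>M over\<^sub>P
  using crossed_mu crossed_lambda by (rule crossed_module_pair.intro)

lemma map_pM_crossed_pairing:
  "crossed_pairing over\<^sub>P over\<^sub>N (tensor over\<^sub>M over\<^sub>N) (\<lambda>(p, n). tensor_gen over\<^sub>M over\<^sub>N (p\<^sub>M p) n)"
  using MN.map_crossed_pairing[OF PN.crossed_module_pair_axioms, of p\<^sub>M "\<lambda>n. n"]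
  by (simp add: pM_hom pM_equivariant hom_in_carrier[OF nu_hom] id_hom)

text \<open>The boundary of \<open>over\<^sub>P\<close> is defined through \<open>p\<^sub>M\<close>,
  so commutativity of the square is what rewrites it through \<open>p\<^sub>N\<close>.\<close>

lemma map_pN_crossed_pairing:
  "crossed_pairing over\<^sub>M over\<^sub>P (tensor over\<^sub>M over\<^sub>N) (\<lambda>(m, p). tensor_gen over\<^sub>M over\<^sub>N m (p\<^sub>N p))"
  using MN.map_crossed_pairing[OF MP.crossed_module_pair_axioms, of "\<lambda>m. m" p\<^sub>N]
  by (simp add: pN_hom pN_equivariant commutes hom_in_carrier[OF mu_hom] id_hom)

lemmas map_pM_hom =
  PN.tensor_lift_hom[OF group_tensor map_pM_crossed_pairing, folded tensor_map_def]
lemmas map_pM_gen =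
  PN.tensor_lift_gen[OF group_tensor map_pM_crossed_pairing, folded tensor_map_def, simplified]
lemmas map_pN_hom =
  MP.tensor_lift_hom[OF group_tensor map_pN_crossed_pairing, folded tensor_map_def]
lemmas map_pN_gen =
  MP.tensor_lift_gen[OF group_tensor map_pN_crossed_pairing, folded tensor_map_def, simplified]

end

sublocale weak_crossed_square \<subseteq> crossed_module_square
  by (rule crossed_module_square.intro[OF group_square_axioms crossed_module_square_axioms.intro])
    (fact W1_pM W1_pN W1_mu W1_nu W1_lambda)+

sublocale crossed_square \<subseteq> crossed_module_square
  by (rule crossed_module_square.intro[OF group_square_axioms crossed_module_square_axioms.intro])
    (fact X1_pM X1_pN X1_mu X1_nu X1_lambda)+

section \<open>From weak crossed squares to crossed squares\<close>

text \<open>The function \<open>k\<close> is prescribed only on the carriers, so that it may be an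
  extensional function.\<close>

lemma (in weak_crossed_square) crossed_square_of_weak:
  assumes k: "\<And>m n. m \<in> carrier M \<Longrightarrow> n \<in> carrier N \<Longrightarrow> k (m, n) = h (tensor_gen over\<^sub>M over\<^sub>N m n)"
  shows "crossed_square L M N P p\<^sub>M p\<^sub>N \<mu> \<nu> act\<^sub>M act\<^sub>N act\<^sub>P k"
proof -
  have gen: "tensor_gen over\<^sub>M over\<^sub>N m n \<in> carrier (tensor over\<^sub>M over\<^sub>N)"
    if "m \<in> carrier M" "n \<in> carrier N" for m n
    using that by (simp add: tensor_gen_closed)
  have closed: "l \<in> carrier L \<Longrightarrow> m \<in> carrier M \<Longrightarrow> act\<^sub>M l m \<in> carrier M"
    "l \<in> carrier L \<Longrightarrow> n \<in> carrier N \<Longrightarrow> act\<^sub>N l n \<in> carrier N" for l m n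
    using MN.A.action.act_closed[of l m] MN.B.action.act_closed[of l n] by simp_all
  have mu: "m \<in> carrier M \<Longrightarrow> \<mu> m \<in> carrier L" for m by (rule hom_in_carrier[OF mu_hom])
  have nu: "n \<in> carrier N \<Longrightarrow> \<nu> n \<in> carrier L" for n by (rule hom_in_carrier[OF nu_hom])
  have pM: "p \<in> carrier P \<Longrightarrow> p\<^sub>M p \<in> carrier M" for p by (rule hom_in_carrier[OF pM_hom])
  have pN: "p \<in> carrier P \<Longrightarrow> p\<^sub>N p \<in> carrier N" for p by (rule hom_in_carrier[OF pN_hom])
  have h_act: "act\<^sub>P l (h (tensor_gen over\<^sub>M over\<^sub>N m n)) =
      h (tensor_gen over\<^sub>M over\<^sub>N (act\<^sub>M l m) (act\<^sub>N l n))"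
    if "l \<in> carrier L" "m \<in> carrier M" "n \<in> carrier N" for l m n
    using W4[OF that(1) gen[OF that(2,3)]] MN.tensor_act_gen[of l m n] that by simp
  have k_act: "act\<^sub>P l (k (m, n)) = k (act\<^sub>M l m, act\<^sub>N l n)"
    if "l \<in> carrier L" "m \<in> carrier M" "n \<in> carrier N" for l m n
    using that by (simp add: k h_act closed)
  \<comment> \<open>Both sides reduce to the image under \<open>h\<close> of a Brown--Loday
    relation, since \<open>h_act\<close> moves the outer action inside \<open>h\<close>.\<close>
  have left: "k (m \<otimes>\<^bsub>M\<^esub> m', n) = act\<^sub>P (\<mu> m) (k (m', n)) \<otimes>\<^bsub>P\<^esub> k (m, n)"
    if "m \<in> carrier M" "m' \<in> carrier M" "n \<in> carrier N" for m m' n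
    using crossed_pairing_left[OF MN.tensor_gen_crossed_pairing, of m m' n] that
    by (simp add: k h_act mu closed gen hom_mult[OF h_hom])
  have right: "k (m, n \<otimes>\<^bsub>N\<^esub> n') = k (m, n) \<otimes>\<^bsub>P\<^esub> act\<^sub>P (\<nu> n) (k (m, n'))"
    if "m \<in> carrier M" "n \<in> carrier N" "n' \<in> carrier N" for m n n'
    using crossed_pairing_right[OF MN.tensor_gen_crossed_pairing, of m n n'] that
    by (simp add: k h_act nu closed gen hom_mult[OF h_hom])
  \<comment> \<open>This is (W.3) at the generator of \<open>P\<close> and \<open>N\<close> given by
    \<open>p\<close> and \<open>n\<close>; \<open>map_pM_gen\<close> identifies its image in the
    tensor product of \<open>M\<close> and \<open>N\<close>.\<close>
  have x3M: "k (p\<^sub>M p, n) = p \<otimes>\<^bsub>P\<^esub> act\<^sub>P (\<nu> n) (inv\<^bsub>P\<^esub> p)"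
    if "p \<in> carrier P" "n \<in> carrier N" for p n
    using W3_M[OF tensor_gen_closed[of p over\<^sub>P n over\<^sub>N]] that pM
      PN.tensor_proj1_gen[of p n] map_pM_gen[of p n]
    by (simp add: k)
  have x3N: "k (m, p\<^sub>N p) = act\<^sub>P (\<mu> m) p \<otimes>\<^bsub>P\<^esub> inv\<^bsub>P\<^esub> p"
    if "m \<in> carrier M" "p \<in> carrier P" for m p
    using W3_N[OF tensor_gen_closed[of m over\<^sub>M p over\<^sub>P]] that pN
      MP.tensor_proj2_gen[of m p] map_pN_gen[of m p]
    by (simp add: k)
  have x2: "p\<^sub>M (k (m, n)) = m \<otimes>\<^bsub>M\<^esub> act\<^sub>M (\<nu> n) (inv\<^bsub>M\<^esub> m)"
    "p\<^sub>N (k (m, n)) = act\<^sub>N (\<mu> m) n \<otimes>\<^bsub>N\<^esub> inv\<^bsub>N\<^esub> n"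
    if "m \<in> carrier M" "n \<in> carrier N" for m n
    using W2_M[OF gen[OF that]] W2_N[OF gen[OF that]] MN.tensor_proj1_gen[of m n]
      MN.tensor_proj2_gen[of m n] that
    by (simp_all add: k)
  have k_closed: "k \<in> carrier M \<times> carrier N \<rightarrow> carrier P"
    by (auto simp: k intro!: hom_in_carrier[OF h_hom] gen)
  show ?thesis
    by (intro crossed_square.intro crossed_square_axioms.intro group_square_axioms)
      (fact k_closed left right W1_pM W1_pN W1_mu W1_nu W1_lambda x2 x3M x3N k_act)+
qed

section \<open>From crossed squares to weak crossed squares\<close>

context crossed_square
begin

text \<open>(X.4) moves the actions in (X.0) inside \<open>h\<close>, which yields the pairing
  rules.\<close>

lemma h_crossed_pairing: "crossed_pairing over\<^sub>M over\<^sub>N P h"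
  using h_closed hom_in_carrier[OF mu_hom] hom_in_carrier[OF nu_hom]
  by (auto simp: crossed_pairing_def X0_left X0_right X4)

lemma weak_crossed_square_of_crossed:
  assumes H: "H \<in> hom (tensor over\<^sub>M over\<^sub>N) P"
    and H_gen: "\<And>m n. m \<in> carrier M \<Longrightarrow> n \<in> carrier N \<Longrightarrow> H (tensor_gen over\<^sub>M over\<^sub>N m n) = h (m, n)"
  shows "weak_crossed_square L M N P p\<^sub>M p\<^sub>N \<mu> \<nu> act\<^sub>M act\<^sub>N act\<^sub>P H"
proof -
  have pM: "p \<in> carrier P \<Longrightarrow> p\<^sub>M p \<in> carrier M" for p by (rule hom_in_carrier[OF pM_hom])
  have pN: "p \<in> carrier P \<Longrightarrow> p\<^sub>N p \<in> carrier N" for p by (rule hom_in_carrier[OF pN_hom])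
  have closed: "l \<in> carrier L \<Longrightarrow> m \<in> carrier M \<Longrightarrow> act\<^sub>M l m \<in> carrier M"
    "l \<in> carrier L \<Longrightarrow> n \<in> carrier N \<Longrightarrow> act\<^sub>N l n \<in> carrier N" for l m n
    using MN.A.action.act_closed[of l m] MN.B.action.act_closed[of l n] by simp_all
  \<comment> \<open>Each of the following axioms compares a composite with \<open>H\<close> to
    another homomorphism on the same tensor product; \<open>H_gen\<close> reduces the comparison to
    the matching axiom for \<open>h\<close>.\<close>
  have w2M: "p\<^sub>M (H t) = tensor_proj1 over\<^sub>M over\<^sub>N t" if t: "t \<in> carrier (tensor over\<^sub>M over\<^sub>N)" for t
    using tensor_hom_eqI[OF M.group_axioms hom_compose[OF H pM_hom], of "tensor_proj1 over\<^sub>M over\<^sub>N" t]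
      MN.tensor_proj1_hom MN.tensor_proj1_gen t
    by (simp add: H_gen X2_M)
  have w2N: "p\<^sub>N (H t) = tensor_proj2 over\<^sub>M over\<^sub>N t" if t: "t \<in> carrier (tensor over\<^sub>M over\<^sub>N)" for t
    using tensor_hom_eqI[OF N.group_axioms hom_compose[OF H pN_hom], of "tensor_proj2 over\<^sub>M over\<^sub>N" t]
      MN.tensor_proj2_hom MN.tensor_proj2_gen t
    by (simp add: H_gen X2_N)
  have w3M: "H (tensor_map over\<^sub>M over\<^sub>N p\<^sub>M (\<lambda>n. n) r) = tensor_proj1 over\<^sub>P over\<^sub>N r"
    if r: "r \<in> carrier (tensor over\<^sub>P over\<^sub>N)" for r
    using tensor_hom_eqI[OF P.group_axioms hom_compose[OF map_pM_hom H], of "tensor_proj1 over\<^sub>P over\<^sub>N" r]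
      PN.tensor_proj1_hom PN.tensor_proj1_gen map_pM_gen r
    by (simp add: H_gen X3_M pM)
  have w3N: "H (tensor_map over\<^sub>M over\<^sub>N (\<lambda>m. m) p\<^sub>N s) = tensor_proj2 over\<^sub>M over\<^sub>P s"
    if s: "s \<in> carrier (tensor over\<^sub>M over\<^sub>P)" for s
    using tensor_hom_eqI[OF P.group_axioms hom_compose[OF map_pN_hom H], of "tensor_proj2 over\<^sub>M over\<^sub>P" s]
      MP.tensor_proj2_hom MP.tensor_proj2_gen map_pN_gen s
    by (simp add: H_gen X3_N pN)
  have w4: "H (tensor_act over\<^sub>M over\<^sub>N l t) = act\<^sub>P l (H t)"
    if l: "l \<in> carrier L" and t: "t \<in> carrier (tensor over\<^sub>M over\<^sub>N)" for l t
    using tensor_hom_eqI[OF P.group_axioms hom_compose[OF MN.tensor_act_hom[OF l] H]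
        hom_compose[OF H PN.A.action.act_endo[OF l, simplified]] _ t]
      MN.tensor_act_gen l
    by (simp add: H_gen X4 closed)
  show ?thesis
    by (intro weak_crossed_square.intro weak_crossed_square_axioms.intro group_square_axioms)
      (fact H X1_pM X1_pN X1_mu X1_nu X1_lambda w2M w2N w3M w3N w4)+
qed

end

section \<open>The bijection between the two structures on a fixed square of groups\<close>

text \<open>Extensional functions are used because values outside the carriers carry no information
  and would otherwise destroy injectivity.\<close>

theorem proposition8p4:
  fixes L :: "'l monoid" and M :: "'m monoid" and N :: "'n monoid" and P :: "'p monoid"
    and p\<^sub>M :: "'p \<Rightarrow> 'm" and p\<^sub>N :: "'p \<Rightarrow> 'n" and \<mu> :: "'m \<Rightarrow> 'l" and \<nu> :: "'n \<Rightarrow> 'l"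
    and act\<^sub>M :: "'l \<Rightarrow> 'm \<Rightarrow> 'm" and act\<^sub>N :: "'l \<Rightarrow> 'n \<Rightarrow> 'n" and act\<^sub>P :: "'l \<Rightarrow> 'p \<Rightarrow> 'p"
  defines "T \<equiv> tensor \<lparr>grp = M, bdry = \<mu>, act = act\<^sub>M\<rparr> \<lparr>grp = N, bdry = \<nu>, act = act\<^sub>N\<rparr>"
    and "gen \<equiv> tensor_gen \<lparr>grp = M, bdry = \<mu>, act = act\<^sub>M\<rparr> \<lparr>grp = N, bdry = \<nu>, act = act\<^sub>N\<rparr>"
  assumes "group_square L M N P p\<^sub>M p\<^sub>N \<mu> \<nu> act\<^sub>M act\<^sub>N act\<^sub>P"
  shows "bij_betw
    (\<lambda>h. \<lambda>(m, n)\<in>carrier M \<times> carrier N. h (gen m n))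
    {h \<in> carrier T \<rightarrow>\<^sub>E carrier P.
       weak_crossed_square L M N P p\<^sub>M p\<^sub>N \<mu> \<nu> act\<^sub>M act\<^sub>N act\<^sub>P h}
    {h \<in> carrier M \<times> carrier N \<rightarrow>\<^sub>E carrier P.
       crossed_square L M N P p\<^sub>M p\<^sub>N \<mu> \<nu> act\<^sub>M act\<^sub>N act\<^sub>P h}"
proof (rule bij_betw_imageI)
  let ?A = "\<lparr>grp = M, bdry = \<mu>, act = act\<^sub>M\<rparr>" and ?B = "\<lparr>grp = N, bdry = \<nu>, act = act\<^sub>N\<rparr>"
  let ?\<Phi> = "\<lambda>h. \<lambda>(m, n)\<in>carrier M \<times> carrier N. h (gen m n)"
  let ?W = "{h \<in> carrier T \<rightarrow>\<^sub>E carrier P.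
    weak_crossed_square L M N P p\<^sub>M p\<^sub>N \<mu> \<nu> act\<^sub>M act\<^sub>N act\<^sub>P h}"
  let ?X = "{h \<in> carrier M \<times> carrier N \<rightarrow>\<^sub>E carrier P.
    crossed_square L M N P p\<^sub>M p\<^sub>N \<mu> \<nu> act\<^sub>M act\<^sub>N act\<^sub>P h}"
  interpret group_square L M N P p\<^sub>M p\<^sub>N \<mu> \<nu> act\<^sub>M act\<^sub>N act\<^sub>P by fact
  have gen_closed: "gen m n \<in> carrier T" if "m \<in> carrier M" "n \<in> carrier N" for m n
    using that tensor_gen_closed[of m ?A n ?B] by (simp add: gen_def T_def)
  show "inj_on ?\<Phi> ?W"
  proof (rule inj_onI)
    fix h k assume h: "h \<in> ?W" and k: "k \<in> ?W" and eq: "?\<Phi> h = ?\<Phi> k"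
    have homs: "h \<in> hom T P" "k \<in> hom T P"
      using h k by (auto simp: T_def dest: weak_crossed_square.h_hom)
    have "h (gen m n) = k (gen m n)" if "m \<in> carrier M" "n \<in> carrier N" for m n
      using fun_cong[OF eq, of "(m, n)"] that by simp
    then have "h t = k t" if "t \<in> carrier T" for t
      using tensor_hom_eqI[OF P.group_axioms homs[unfolded T_def], of t] that
      by (simp add: gen_def T_def)
    then show "h = k" using h k by (auto intro: PiE_ext)
  qed
  show "?\<Phi> ` ?W = ?X"
  proof (intro equalityI subsetI)
    fix k assume "k \<in> ?\<Phi> ` ?W"
    then obtain h where h: "h \<in> ?W" and k: "k = ?\<Phi> h" by blast
    interpret weak_crossed_square L M N P p\<^sub>M p\<^sub>N \<mu> \<nu> act\<^sub>M act\<^sub>N act\<^sub>P h using h by simp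
    have "crossed_square L M N P p\<^sub>M p\<^sub>N \<mu> \<nu> act\<^sub>M act\<^sub>N act\<^sub>P k"
      by (rule crossed_square_of_weak) (simp add: k gen_def)
    then show "k \<in> ?X" using h gen_closed by (auto simp: k)
  next
    fix k assume k: "k \<in> ?X"
    interpret crossed_square L M N P p\<^sub>M p\<^sub>N \<mu> \<nu> act\<^sub>M act\<^sub>N act\<^sub>P k using k by simp
    \<comment> \<open>The preimage of \<open>k\<close> is the homomorphism induced by the universal
      property, restricted so as to be extensional.\<close>
    define h where "h = restrict (pres_lift P k) (carrier T)"
    \<comment> \<open>Closure of \<open>T\<close> under products keeps the restriction
      multiplicative.\<close>
    have hom: "h \<in> hom T P"
      using MN.tensor_lift_hom[OF P.group_axioms h_crossed_pairing]
        monoid.m_closed[OF group.is_monoid[OF group_tensor]]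
      unfolding h_def T_def hom_def by (auto simp: Pi_iff)
    have h_gen: "h (gen m n) = k (m, n)" if "m \<in> carrier M" "n \<in> carrier N" for m n
      using MN.tensor_lift_gen[OF P.group_axioms h_crossed_pairing, of m n] gen_closed that
      by (simp add: h_def gen_def)
    have "weak_crossed_square L M N P p\<^sub>M p\<^sub>N \<mu> \<nu> act\<^sub>M act\<^sub>N act\<^sub>P h"
      using weak_crossed_square_of_crossed[of h] hom h_gen by (simp add: T_def gen_def)
    then have "h \<in> ?W"
      using hom_in_carrier[OF hom] by (auto simp: h_def)
    \<comment> \<open>Outside the carriers both sides are \<open>undefined\<close>, as
      \<open>k\<close> is extensional.\<close>
    moreover have "k = ?\<Phi> h"
      using k h_gen by (intro ext) (auto simp: PiE_def extensional_def)
    ultimately show "k \<in> ?\<Phi> ` ?W" by blast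
  qed
qed

end
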